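(* Let $d\ge2$, let $A$ and $B$ be quantum systems with Hilbert spaces of dimension $d$ and non-degenerate (finite-energy) Hamiltonians, and let $\gamma_A,\gamma_B$ be their thermal states at temperatures $T_A,T_B$. Let $P_{\min}$ be the smallest eigenvalue among those of $\gamma_A$ and $\gamma_B$, let $0\le\epsilon\le dP_{\min}$, and define on states $\rho$ of $AB$ $$\mathcal{E}^{\epsilon}(\rho)=(1-\epsilon)\,\eta_A^{\epsilon}\otimes\eta_B^{\epsilon}+\epsilon\,\mathcal{T}(\rho),\qquad \eta_X^\epsilon=\gamma_X+\frac{\epsilon}{1-\epsilon}\Big(\gamma_X-\frac{\mathbb{I}_X}{d}\Big)\ (X=A,B).$$ Then for all input states $\rho_{AB}$, $$\mathcal{F}_{\max}[\mathcal{E}^\epsilon(\rho_{AB})]\ \ge\ \epsilon\,\langle\Psi_d^+|\rho_{AB}|\Psi_d^+\rangle .$$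
   Context: The thermal state of a Hamiltonian $H_X$ at temperature $T_X$ is $\gamma_X=e^{-H_X/kT_X}/\mathrm{tr}(e^{-H_X/kT_X})$, $k>0$ Boltzmann's constant (at $T_X=0$: the projector onto the ground state). The orthonormal basis $\{|n\rangle\}_{n=0}^{d-1}$ of each local system is its energy eigenbasis ordered by increasing energy; complex conjugation $U^*$ is taken in this basis, and $|\Psi_d^+\rangle=\frac1{\sqrt d}\sum_{n=0}^{d-1}|n\rangle\otimes|n\rangle$. The twirling operation is $\mathcal{T}(\rho)=\int_{U(d)}(U\otimes U^* )\rho(U\otimes U^* )^\dagger dU$, with $dU$ the normalized Haar measure on the unitary group $U(d)$. The fully entangled fraction of a state $\rho$ on $\mathbb{C}^d\otimes\mathbb{C}^d$ is $\mathcal{F}_{\max}(\rho)=\max_{|\Phi_d\rangle}\langle\Phi_d|\rho|\Phi_d\rangle$, the maximum over all maximally entangled states $|\Phi_d\rangle\in\mathbb{C}^d\otimes\mathbb{C}^d$. *)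

theory Defs
  imports "HOL-Probability.Probability"
begin

text \<open>
  A \<open>d\<close>-dimensional Hilbert space is \<open>complex ^ 'n\<close> with \<open>CARD('n) = d\<close>, operators on it are
  \<open>complex ^ 'n ^ 'n\<close>, and the composite of two such systems is \<open>complex ^ ('n \<times> 'n)\<close>.
  Multiplication of operators is \<open>**\<close> throughout; the type class operation \<open>*\<close> on
  \<open>complex ^ 'n ^ 'n\<close> is the entrywise product and is never used.
\<close>

subsection \<open>Linear algebra\<close>

text \<open>The library's \<open>\<bullet>\<close> on \<open>complex ^ 'n\<close> is only the real part of the following.\<close>

definition cinner :: "complex ^ 'n \<Rightarrow> complex ^ 'n \<Rightarrow> complex" where
  "cinner v w = (\<Sum>i\<in>UNIV. cnj (v $ i) * w $ i)"

definition dagger :: "complex ^ 'n ^ 'm \<Rightarrow> complex ^ 'm ^ 'n" where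
  "dagger M = (\<chi> i j. cnj (M $ j $ i))"

definition cnj_mat :: "complex ^ 'n ^ 'm \<Rightarrow> complex ^ 'n ^ 'm" where
  "cnj_mat M = (\<chi> i j. cnj (M $ i $ j))"

definition hermitian :: "complex ^ 'n ^ 'n \<Rightarrow> bool" where
  "hermitian M \<longleftrightarrow> dagger M = M"

definition unitary_group :: "(complex ^ 'n ^ 'n) set" where
  "unitary_group = {U. dagger U ** U = mat 1 \<and> U ** dagger U = mat 1}"

definition expval :: "complex ^ 'n ^ 'n \<Rightarrow> complex ^ 'n \<Rightarrow> complex" where
  "expval M v = cinner v (M *v v)"

definition outer :: "complex ^ 'm \<Rightarrow> complex ^ 'n \<Rightarrow> complex ^ 'n ^ 'm" where
  "outer v w = (\<chi> i j. v $ i * cnj (w $ j))"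

definition tensor_vec :: "complex ^ 'm \<Rightarrow> complex ^ 'n \<Rightarrow> complex ^ ('m \<times> 'n)" where
  "tensor_vec v w = (\<chi> p. v $ fst p * w $ snd p)"

definition tensor_mat ::
  "complex ^ 'm ^ 'm \<Rightarrow> complex ^ 'n ^ 'n \<Rightarrow> complex ^ ('m \<times> 'n) ^ ('m \<times> 'n)" where
  "tensor_mat A B = (\<chi> p q. A $ fst p $ fst q * B $ snd p $ snd q)"

text \<open>An orthonormal family indexed by \<open>'n\<close> has \<open>CARD('n)\<close> members, so it is a basis.\<close>

definition orthonormal_basis :: "('n \<Rightarrow> complex ^ 'n) \<Rightarrow> bool" where
  "orthonormal_basis a \<longleftrightarrow> (\<forall>m n. cinner (a m) (a n) = (if m = n then 1 else 0))"

text \<open>The operator whose matrix elements in the basis \<open>a\<close> are the entries of \<open>M\<close>.\<close>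

definition op_of_matrix :: "('n \<Rightarrow> complex ^ 'n) \<Rightarrow> complex ^ 'n ^ 'n \<Rightarrow> complex ^ 'n ^ 'n" where
  "op_of_matrix a M = (\<chi> i j. \<Sum>m\<in>UNIV. \<Sum>n\<in>UNIV. M $ m $ n * outer (a m) (a n) $ i $ j)"

text \<open>For Hermitian operators these are all the eigenvalues.\<close>

definition real_eigenvalues :: "complex ^ 'n ^ 'n \<Rightarrow> real set" where
  "real_eigenvalues M = {x. \<exists>v. v \<noteq> 0 \<and> M *v v = complex_of_real x *s v}"

definition mat_exp :: "complex ^ 'n ^ 'n \<Rightarrow> complex ^ 'n ^ 'n" where
  "mat_exp M = (\<Sum>k. (1 / fact k) *\<^sub>R (((**) M) ^^ k) (mat 1))"

subsection \<open>States\<close>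

definition density_operator :: "complex ^ 'n ^ 'n \<Rightarrow> bool" where
  "density_operator \<rho> \<longleftrightarrow>
     hermitian \<rho> \<and> (\<forall>v. 0 \<le> Re (expval \<rho> v)) \<and> trace \<rho> = 1"

text \<open>\<open>max_entangled_vec\<close> of the energy eigenbases is \<open>|\<Psi>\<^sup>+\<^sub>d\<rangle>\<close>.\<close>

definition max_entangled_vec ::
  "('n::finite \<Rightarrow> complex ^ 'n) \<Rightarrow> ('n \<Rightarrow> complex ^ 'n) \<Rightarrow> complex ^ ('n \<times> 'n)" where
  "max_entangled_vec a b =
     (1 / sqrt (real CARD('n))) *\<^sub>R (\<Sum>n\<in>UNIV. tensor_vec (a n) (b n))"

definition maximally_entangled :: "complex ^ ('n::finite \<times> 'n) \<Rightarrow> bool" where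
  "maximally_entangled \<Phi> \<longleftrightarrow>
     (\<exists>e f. orthonormal_basis e \<and> orthonormal_basis f \<and> \<Phi> = max_entangled_vec e f)"

text \<open>The supremum is over a nonempty compact set, so it is attained.\<close>

definition fully_entangled_fraction :: "complex ^ ('n::finite \<times> 'n) ^ ('n \<times> 'n) \<Rightarrow> real" where
  "fully_entangled_fraction \<rho> = (SUP \<Phi>\<in>{\<Phi>. maximally_entangled \<Phi>}. Re (expval \<rho> \<Phi>))"

subsection \<open>Hamiltonians and thermal states\<close>

definition nondegenerate :: "complex ^ 'n ^ 'n \<Rightarrow> bool" where
  "nondegenerate H \<longleftrightarrow>
     (\<forall>x v w. v \<noteq> 0 \<and> H *v v = x *s v \<and> H *v w = x *s w \<longrightarrow> (\<exists>c. w = c *s v))"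

text \<open>
  The order on the index type \<open>'n\<close> is the order of the labels \<open>0, \<dots>, d - 1\<close>. The basis vectors
  are determined by the Hamiltonian only up to phases, so the basis is a separate datum.
\<close>

definition energy_eigenbasis ::
  "complex ^ 'n::{finite,linorder} ^ 'n::{finite,linorder} \<Rightarrow>
   ('n \<Rightarrow> complex ^ 'n::{finite,linorder}) \<Rightarrow> bool" where
  "energy_eigenbasis H a \<longleftrightarrow> orthonormal_basis a \<and>
     (\<exists>E :: 'n \<Rightarrow> real. mono E \<and> (\<forall>n. H *v a n = complex_of_real (E n) *s a n))"

definition ground_state :: "complex ^ 'n ^ 'n \<Rightarrow> complex ^ 'n \<Rightarrow> bool" where
  "ground_state H v \<longleftrightarrow>
     cinner v v = 1 \<and> H *v v = complex_of_real (Min (real_eigenvalues H)) *s v"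

text \<open>
  For a nondegenerate \<open>H\<close> the ground state is unique up to a phase, which cancels in
  \<open>outer v v\<close>.
\<close>

definition thermal_state :: "real \<Rightarrow> real \<Rightarrow> complex ^ 'n ^ 'n \<Rightarrow> complex ^ 'n ^ 'n" where
  "thermal_state k T H =
     (if T = 0 then THE P. \<exists>v. ground_state H v \<and> P = outer v v
      else let G = mat_exp ((- 1 / (k * T)) *\<^sub>R H) in \<chi> i j. G $ i $ j / trace G)"

definition min_eigenvalue :: "complex ^ 'n ^ 'n \<Rightarrow> complex ^ 'n ^ 'n \<Rightarrow> real" where
  "min_eigenvalue \<gamma>\<^sub>A \<gamma>\<^sub>B = Min (real_eigenvalues \<gamma>\<^sub>A \<union> real_eigenvalues \<gamma>\<^sub>B)"

subsection \<open>Twirling\<close>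

text \<open>
  Left invariance and normalization characterize the Haar measure of a compact group;
  right invariance follows.
\<close>

definition normalized_haar_measure :: "(complex ^ 'n ^ 'n) measure \<Rightarrow> bool" where
  "normalized_haar_measure \<mu> \<longleftrightarrow>
     sets \<mu> = sets (restrict_space borel unitary_group) \<and> prob_space \<mu> \<and>
     (\<forall>V\<in>unitary_group. distr \<mu> \<mu> (\<lambda>U. V ** U) = \<mu>)"

text \<open>
  \<open>a\<close> and \<open>b\<close> are the distinguished bases of the two systems: they identify a matrix \<open>U\<close> with
  an operator on each system, and the complex conjugate is that of the matrix elements.
\<close>

definition twirl ::
  "(complex ^ 'n ^ 'n) measure \<Rightarrow> ('n \<Rightarrow> complex ^ 'n) \<Rightarrow> ('n \<Rightarrow> complex ^ 'n) \<Rightarrow>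
   complex ^ ('n \<times> 'n) ^ ('n \<times> 'n) \<Rightarrow> complex ^ ('n \<times> 'n) ^ ('n \<times> 'n)" where
  "twirl \<mu> a b \<rho> =
     (\<integral>U. (let W = tensor_mat (op_of_matrix a U) (op_of_matrix b (cnj_mat U))
           in W ** \<rho> ** dagger W) \<partial>\<mu>)"

definition eta :: "real \<Rightarrow> complex ^ 'n ^ 'n \<Rightarrow> complex ^ 'n ^ 'n" where
  "eta \<epsilon> \<gamma> = \<gamma> + (\<epsilon> / (1 - \<epsilon>)) *\<^sub>R (\<gamma> - (1 / real CARD('n)) *\<^sub>R mat 1)"

definition thermal_channel ::
  "(complex ^ 'n ^ 'n) measure \<Rightarrow> ('n \<Rightarrow> complex ^ 'n) \<Rightarrow> ('n \<Rightarrow> complex ^ 'n) \<Rightarrow>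
   complex ^ 'n ^ 'n \<Rightarrow> complex ^ 'n ^ 'n \<Rightarrow> real \<Rightarrow>
   complex ^ ('n \<times> 'n) ^ ('n \<times> 'n) \<Rightarrow> complex ^ ('n \<times> 'n) ^ ('n \<times> 'n)" where
  "thermal_channel \<mu> a b \<gamma>\<^sub>A \<gamma>\<^sub>B \<epsilon> \<rho> =
     (1 - \<epsilon>) *\<^sub>R tensor_mat (eta \<epsilon> \<gamma>\<^sub>A) (eta \<epsilon> \<gamma>\<^sub>B) + \<epsilon> *\<^sub>R twirl \<mu> a b \<rho>"

end

theory Submission
  imports Defs
begin

text \<open>
  The vector \<open>|\<Psi>\<^sup>+\<rangle>\<close> built from the energy eigenbases is itself maximally entangled, so it
  suffices to bound its expectation value. It is invariant under every \<open>(U \<otimes> U\<^sup>*)\<^sup>\<dagger>\<close>, hence the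
  twirl does not change that expectation value. Thermal states are diagonal in the energy
  eigenbasis, so \<open>\<eta>\<^sub>A \<otimes> \<eta>\<^sub>B\<close> is too, and \<open>\<epsilon> \<le> d P\<^sub>m\<^sub>i\<^sub>n \<le> 1\<close> makes its eigenvalues and the
  weight \<open>1 - \<epsilon>\<close> nonnegative; that term can be dropped.
\<close>

subsection \<open>Inner products and tensor products\<close>

lemma cinner_sum_right: "cinner v (\<Sum>i\<in>S. f i) = (\<Sum>i\<in>S. cinner v (f i))"
  unfolding cinner_def sum_component sum_distrib_left by (rule sum.swap)

lemma cinner_sum_left: "cinner (\<Sum>i\<in>S. f i) v = (\<Sum>i\<in>S. cinner (f i) v)"
  unfolding cinner_def sum_component cnj_sum sum_distrib_right by (rule sum.swap)

lemma cinner_scale_right: "cinner v (c *s w) = c * cinner v w"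
  by (simp add: cinner_def sum_distrib_left ac_simps)

lemma cinner_scaleR_right: "cinner v (r *\<^sub>R w) = r *\<^sub>R cinner v w"
  by (simp add: cinner_def scaleR_sum_right)

lemma cinner_scaleR_left: "cinner (r *\<^sub>R v) w = r *\<^sub>R cinner v w"
  by (simp add: cinner_def scaleR_sum_right)

lemma cinner_add_right: "cinner v (w + z) = cinner v w + cinner v z"
  by (simp add: cinner_def algebra_simps sum.distrib)

lemma cinner_mult_dagger:
  "cinner v (M *v w) = cinner (dagger M *v v) w"
proof -
  have "cinner v (M *v w) = (\<Sum>i\<in>UNIV. \<Sum>j\<in>UNIV. cnj (v $ i) * (M $ i $ j * w $ j))"
    by (simp add: cinner_def matrix_vector_mult_def sum_distrib_left)
  also have "\<dots> = (\<Sum>j\<in>UNIV. \<Sum>i\<in>UNIV. cnj (v $ i) * (M $ i $ j * w $ j))"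
    by (rule sum.swap)
  also have "\<dots> = cinner (dagger M *v v) w"
    by (simp add: cinner_def dagger_def matrix_vector_mult_def sum_distrib_right)
      (simp add: ac_simps)
  finally show ?thesis .
qed

text \<open>Conjugating the operator amounts to moving the vector by \<open>dagger W\<close>. In
  this form a vector fixed by \<open>dagger W\<close> gets the same expectation before and after
  conjugation.\<close>

lemma expval_conjugate: "expval (W ** \<rho> ** dagger W) v = expval \<rho> (dagger W *v v)"
  by (simp add: expval_def cinner_mult_dagger matrix_vector_mul_assoc[symmetric])

lemma scaleR_matrix_vec:
  "(r *\<^sub>R M) *v v = r *\<^sub>R (M *v v)" for M :: "complex ^ 'n ^ 'm"
  by (simp add: vec_eq_iff matrix_vector_mult_def scaleR_sum_right)

lemma matrix_vec_scaleR:
  "M *v (r *\<^sub>R v) = r *\<^sub>R (M *v v)" for M :: "complex ^ 'n ^ 'm"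
  by (simp add: vec_eq_iff matrix_vector_mult_def scaleR_sum_right)

text \<open>Real linearity in the operator is enough to split the channel into its two terms and, in
  finite dimension, to pull the expectation through an integral.\<close>

lemma linear_expval: "linear (\<lambda>M. expval M v)"
  by (rule linearI)
    (simp_all add: expval_def matrix_vector_mult_add_rdistrib cinner_add_right
      scaleR_matrix_vec cinner_scaleR_right)

lemma sum_UNIV_prod:
  "(\<Sum>p\<in>(UNIV :: ('a::finite \<times> 'b::finite) set). f p) = (\<Sum>i\<in>UNIV. \<Sum>j\<in>UNIV. f (i, j))"
  by (simp add: sum.cartesian_product)

lemma cinner_tensor_vec:
  "cinner (tensor_vec v w) (tensor_vec v' w') = cinner v v' * cinner w w'"
  by (simp add: cinner_def tensor_vec_def sum_product sum_UNIV_prod ac_simps)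

lemma tensor_mat_vec: "tensor_mat M N *v tensor_vec v w = tensor_vec (M *v v) (N *v w)"
  by (simp add: vec_eq_iff matrix_vector_mult_def tensor_mat_def tensor_vec_def sum_product
      sum_UNIV_prod ac_simps)

lemma tensor_vec_scale: "tensor_vec (c *s v) (c' *s w) = (c * c') *s tensor_vec v w"
  by (simp add: vec_eq_iff tensor_vec_def ac_simps)

lemma tensor_vec_sum:
  "tensor_vec (\<Sum>i\<in>S. f i) (\<Sum>j\<in>T. g j) = (\<Sum>i\<in>S. \<Sum>j\<in>T. tensor_vec (f i) (g j))"
  by (simp add: vec_eq_iff tensor_vec_def sum_product)

lemma dagger_tensor_mat: "dagger (tensor_mat M N) = tensor_mat (dagger M) (dagger N)"
  by (simp add: vec_eq_iff dagger_def tensor_mat_def)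

subsection \<open>Orthonormal bases\<close>

lemma orthonormal_basis_cinner:
  "orthonormal_basis a \<Longrightarrow> cinner (a m) (a n) = (if m = n then 1 else 0)"
  by (simp add: orthonormal_basis_def)

text \<open>Orthonormality makes \<open>dagger A\<close> a left inverse of the square matrix
  \<open>A\<close> whose columns are the basis vectors, hence also a right inverse; the latter is
  completeness.\<close>

lemma orthonormal_basis_complete:
  fixes a :: "'n::finite \<Rightarrow> complex ^ 'n"
  assumes "orthonormal_basis a"
  shows "(\<Sum>n\<in>UNIV. a n $ i * cnj (a n $ j)) = (if i = j then 1 else 0)"
proof -
  define A :: "complex ^ 'n ^ 'n" where "A = (\<chi> i n. a n $ i)"
  have "dagger A ** A = mat 1"
    using assms
    by (simp add: vec_eq_iff A_def dagger_def matrix_matrix_mult_def mat_def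
        orthonormal_basis_def cinner_def)
  then have "A ** dagger A = mat 1"
    using matrix_left_right_inverse by blast
  then have "(A ** dagger A) $ i $ j = (if i = j then 1 else 0)"
    by (simp add: mat_def)
  then show ?thesis
    by (simp add: A_def dagger_def matrix_matrix_mult_def)
qed

text \<open>This is \<open>M\<close> composed with the resolution of the identity in the basis
  \<open>a\<close>.\<close>

lemma matrix_expansion:
  fixes a :: "'n::finite \<Rightarrow> complex ^ 'n" and M :: "complex ^ 'n ^ 'n"
  assumes "orthonormal_basis a"
  shows "M = (\<Sum>n\<in>UNIV. outer (M *v a n) (a n))"
proof -
  have "(\<Sum>n\<in>UNIV. outer (M *v a n) (a n)) $ i $ j = M $ i $ j" for i j
  proof -
    have "(\<Sum>n\<in>UNIV. outer (M *v a n) (a n)) $ i $ j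
        = (\<Sum>n\<in>UNIV. \<Sum>k\<in>UNIV. M $ i $ k * (a n $ k * cnj (a n $ j)))"
      by (simp add: outer_def matrix_vector_mult_def sum_distrib_right) (simp add: ac_simps)
    also have "\<dots> = (\<Sum>k\<in>UNIV. \<Sum>n\<in>UNIV. M $ i $ k * (a n $ k * cnj (a n $ j)))"
      by (rule sum.swap)
    also have "\<dots> = M $ i $ j"
      by (simp add: sum_distrib_left[symmetric] orthonormal_basis_complete[OF assms]
          if_distrib cong: if_cong)
    finally show ?thesis .
  qed
  then show ?thesis
    by (simp add: vec_eq_iff)
qed

section \<open>Operators diagonal in an orthonormal basis\<close>

lemma diagonal_expansion:
  fixes a :: "'n::finite \<Rightarrow> complex ^ 'n"
  assumes "orthonormal_basis a" and "\<And>n. M *v a n = complex_of_real (x n) *s a n"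
  shows "M = (\<Sum>n\<in>UNIV. x n *\<^sub>R outer (a n) (a n))"
proof -
  have "outer (M *v a n) (a n) = x n *\<^sub>R outer (a n) (a n)" for n
    using assms(2)[of n] by (simp add: vec_eq_iff outer_def) (simp add: scaleR_conv_of_real[where 'a = complex])
  then show ?thesis
    using matrix_expansion[OF assms(1), of M] by simp
qed

lemma outer_vec: "outer v w *v z = cinner w z *s v"
  by (simp add: vec_eq_iff outer_def matrix_vector_mult_def cinner_def sum_distrib_left
      sum_distrib_right ac_simps)

lemma sum_matrix_vec: "(\<Sum>i\<in>S. M i) *v v = (\<Sum>i\<in>S. M i *v v)"
  by (induction S rule: infinite_finite_induct)
    (simp_all add: matrix_vector_mult_add_rdistrib)

lemma diagonal_vec:
  assumes "orthonormal_basis a"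
  shows "(\<Sum>n\<in>UNIV. x n *\<^sub>R outer (a n) (a n)) *v a m = complex_of_real (x m) *s a m"
proof -
  have "(\<Sum>n\<in>UNIV. x n *\<^sub>R outer (a n) (a n)) *v a m
      = (\<Sum>n\<in>UNIV. if n = m then complex_of_real (x m) *s a m else 0)"
    unfolding sum_matrix_vec scaleR_matrix_vec outer_vec
    by (rule sum.cong)
      (auto simp: orthonormal_basis_cinner[OF assms] vec_eq_iff scaleR_conv_of_real[where 'a = complex])
  then show ?thesis
    by simp
qed

lemma trace_diagonal:
  assumes "orthonormal_basis a"
  shows "trace (\<Sum>n\<in>UNIV. x n *\<^sub>R outer (a n) (a n)) = complex_of_real (\<Sum>n\<in>UNIV. x n)"
proof -
  have "trace (\<Sum>n\<in>UNIV. x n *\<^sub>R outer (a n) (a n))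
      = (\<Sum>i\<in>UNIV. \<Sum>n\<in>UNIV. x n *\<^sub>R (cnj (a n $ i) * a n $ i))"
    by (simp add: trace_def outer_def ac_simps)
  also have "\<dots> = (\<Sum>n\<in>UNIV. \<Sum>i\<in>UNIV. x n *\<^sub>R (cnj (a n $ i) * a n $ i))"
    by (rule sum.swap)
  also have "\<dots> = (\<Sum>n\<in>UNIV. x n *\<^sub>R cinner (a n) (a n))"
    by (simp add: cinner_def scaleR_sum_right)
  also have "\<dots> = complex_of_real (\<Sum>n\<in>UNIV. x n)"
    by (simp add: orthonormal_basis_cinner[OF assms] scaleR_conv_of_real[where 'a = complex])
  finally show ?thesis .
qed

lemma orthonormal_basis_nonzero: "orthonormal_basis a \<Longrightarrow> a n \<noteq> 0"
  using orthonormal_basis_cinner[of a n n] by (auto simp: cinner_def)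

text \<open>This turns each \<open>Min\<close> over a spectrum, for the ground energy and for the
  smallest thermal eigenvalue, into a minimum over a finite nonempty range.\<close>

lemma real_eigenvalues_diagonal:
  fixes a :: "'n::finite \<Rightarrow> complex ^ 'n"
  assumes a: "orthonormal_basis a" and M: "\<And>n. M *v a n = complex_of_real (x n) *s a n"
  shows "real_eigenvalues M = range x"
proof (intro equalityI subsetI)
  fix y assume "y \<in> range x"
  then show "y \<in> real_eigenvalues M"
    using M orthonormal_basis_nonzero[OF a] by (auto simp: real_eigenvalues_def)
next
  fix y assume "y \<in> real_eigenvalues M"
  then obtain v where v: "v \<noteq> 0" "M *v v = complex_of_real y *s v"
    by (auto simp: real_eigenvalues_def)
  \<comment> \<open>The resolution of the identity applied to \<open>v\<close>. Some coefficient of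
    \<open>v\<close> is therefore nonzero, and comparing that coefficient in the eigenvalue equation
    identifies \<open>y\<close>.\<close>
  have "(\<Sum>n\<in>UNIV. cinner (a n) v *s a n) = v"
    using arg_cong[OF matrix_expansion[OF a, of "mat 1"], of "\<lambda>N. N *v v"]
    by (simp add: sum_matrix_vec outer_vec)
  then obtain n where n: "cinner (a n) v \<noteq> 0"
    using v(1) by (metis (no_types, lifting) sum.neutral vector_smult_lzero)
  have "M *v v = (\<Sum>m\<in>UNIV. x m *\<^sub>R (cinner (a m) v *s a m))"
    by (subst diagonal_expansion[OF a M])
      (simp add: sum_matrix_vec scaleR_matrix_vec outer_vec)
  then have "cinner (a n) (M *v v) = complex_of_real (x n) * cinner (a n) v"
    by (simp add: cinner_sum_right cinner_scale_right cinner_scaleR_right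
        orthonormal_basis_cinner[OF a] scaleR_conv_of_real[where 'a = complex] if_distrib cong: if_cong)
  then have "complex_of_real y * cinner (a n) v = complex_of_real (x n) * cinner (a n) v"
    by (simp add: v(2) cinner_scale_right)
  then show "y \<in> range x"
    using n by simp
qed

lemma op_of_matrix_basis:
  assumes "orthonormal_basis a"
  shows "op_of_matrix a M *v a n = (\<Sum>m\<in>UNIV. M $ m $ n *s a m)"
proof -
  have "op_of_matrix a M = (\<Sum>m\<in>UNIV. \<Sum>l\<in>UNIV. outer (M $ m $ l *s a m) (a l))"
    by (simp add: vec_eq_iff op_of_matrix_def outer_def ac_simps)
  then show ?thesis
    by (simp add: sum_matrix_vec outer_vec orthonormal_basis_cinner[OF assms]
        if_distrib[of "\<lambda>c. c * _"] if_distrib[of "\<lambda>c. c *s _"] cong: if_cong)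
qed

lemma dagger_op_of_matrix: "dagger (op_of_matrix a M) = op_of_matrix a (dagger M)"
proof -
  have "cnj (\<Sum>m\<in>UNIV. \<Sum>n\<in>UNIV. M $ m $ n * outer (a m) (a n) $ j $ i)
      = (\<Sum>m\<in>UNIV. \<Sum>n\<in>UNIV. cnj (M $ n $ m) * outer (a m) (a n) $ i $ j)" for i j
    by (subst sum.swap) (simp add: outer_def ac_simps)
  then show ?thesis
    by (simp add: vec_eq_iff dagger_def op_of_matrix_def)
qed

text \<open>A crude entrywise bound that serves two compactness-type arguments: boundedness of the
  maximally entangled vectors and of the unitary group.\<close>

lemma norm_orthonormal_basis_le_1:
  assumes "orthonormal_basis a"
  shows "norm (a n $ i) \<le> 1"
proof -
  have "complex_of_real (\<Sum>i\<in>UNIV. (norm (a n $ i))\<^sup>2) = 1"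
    using orthonormal_basis_cinner[OF assms, of n n]
    by (simp add: cinner_def complex_norm_square ac_simps del: of_real_power)
  then have "(\<Sum>i\<in>UNIV. (norm (a n $ i))\<^sup>2) = 1"
    using of_real_eq_1_iff by blast
  then have "(norm (a n $ i))\<^sup>2 \<le> 1"
    using member_le_sum[of i UNIV "\<lambda>i. (norm (a n $ i))\<^sup>2"] by simp
  then show ?thesis
    by (simp add: power_le_one_iff abs_square_le_1)
qed

subsection \<open>Thermal states\<close>

text \<open>The powers of \<open>M\<close> act on \<open>a n\<close> by powers of
  \<open>x n\<close>, so the matrix series splits into one scalar exponential series per basis
  projector.\<close>

lemma mat_exp_diagonal:
  fixes a :: "'n::finite \<Rightarrow> complex ^ 'n"
  assumes a: "orthonormal_basis a" and M: "\<And>n. M *v a n = complex_of_real (x n) *s a n"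
  shows "mat_exp M = (\<Sum>n\<in>UNIV. exp (x n) *\<^sub>R outer (a n) (a n))"
proof -
  have pow: "(((**) M) ^^ k) (mat 1) *v a n = complex_of_real (x n ^ k) *s a n" for k n
    by (induction k)
      (simp_all add: matrix_vector_mul_assoc[symmetric] M vector_scalar_commute)
  have "(1 / fact k) *\<^sub>R (((**) M) ^^ k) (mat 1)
      = (\<Sum>n\<in>UNIV. (x n ^ k /\<^sub>R fact k) *\<^sub>R outer (a n) (a n))" for k
    by (subst diagonal_expansion[OF a pow]) (simp add: scaleR_sum_right divide_inverse ac_simps)
  moreover have "(\<lambda>k. \<Sum>n\<in>UNIV. (x n ^ k /\<^sub>R fact k) *\<^sub>R outer (a n) (a n))
      sums (\<Sum>n\<in>UNIV. exp (x n) *\<^sub>R outer (a n) (a n))"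
    by (intro sums_sum bounded_linear.sums[OF bounded_linear_scaleR_left] exp_converges)
  ultimately show ?thesis
    by (simp add: mat_exp_def sums_iff)
qed

text \<open>Zero and nonzero temperature are brought to one form: all weight on the ground projector
  in the first case, normalized Boltzmann weights in the second.\<close>

lemma thermal_state_diagonal:
  fixes H :: "complex ^ 'n::{finite,linorder} ^ 'n::{finite,linorder}"
  assumes nd: "nondegenerate H" and ea: "energy_eigenbasis H a"
  obtains p where "thermal_state k T H = (\<Sum>n\<in>UNIV. p n *\<^sub>R outer (a n) (a n))"
    and "(\<Sum>n\<in>UNIV. p n) = 1"
proof -
  from ea obtain E where a: "orthonormal_basis a"
    and E: "\<And>n. H *v a n = complex_of_real (E n) *s a n"
    unfolding energy_eigenbasis_def by blast
  show thesis
  proof (cases "T = 0")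
    case True
    have "Min (range E) \<in> range E"
      by (rule Min_in) auto
    then obtain g where g: "E g = Min (range E)"
      by fastforce
    have gs: "ground_state H v \<longleftrightarrow> cinner v v = 1 \<and> H *v v = complex_of_real (E g) *s v" for v
      by (simp add: ground_state_def real_eigenvalues_diagonal[OF a E] g)
    \<comment> \<open>Uniqueness for the definite description: by nondegeneracy \<open>v\<close> is
      a multiple of \<open>a g\<close>, and normalization makes the factor a phase, which the
      projector does not see.\<close>
    have "outer v v = outer (a g) (a g)" if v: "ground_state H v" for v
    proof -
      obtain c where c: "v = c *s a g"
        using nd[unfolded nondegenerate_def, rule_format, of "a g" "complex_of_real (E g)" v]
          v E orthonormal_basis_nonzero[OF a] gs by auto
      have "cinner v v = cnj c * c * cinner (a g) (a g)"
        by (simp add: c cinner_def sum_distrib_left ac_simps)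
      then have "c * cnj c = 1"
        using v by (simp add: gs orthonormal_basis_cinner[OF a] ac_simps)
      moreover have "outer v v $ i $ j = (c * cnj c) * outer (a g) (a g) $ i $ j" for i j
        by (simp add: c outer_def)
      ultimately have "outer v v $ i $ j = outer (a g) (a g) $ i $ j" for i j
        by (simp only: mult_1_left)
      then show ?thesis
        unfolding vec_eq_iff by blast
    qed
    moreover have "ground_state H (a g)"
      by (simp add: gs E orthonormal_basis_cinner[OF a])
    ultimately have "(THE P. \<exists>v. ground_state H v \<and> P = outer v v) = outer (a g) (a g)"
      by (intro the_equality) metis+
    also have "\<dots> = (\<Sum>n\<in>UNIV. (if n = g then 1 else 0) *\<^sub>R outer (a n) (a n))"
      by (simp add: if_distrib[of "\<lambda>r. r *\<^sub>R _"] cong: if_cong)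
    finally show thesis
      using True that[of "\<lambda>n. if n = g then 1 else 0"] by (simp add: thermal_state_def)
  next
    case False
    define x where "x n = exp (- 1 / (k * T) * E n)" for n
    define Z where "Z = (\<Sum>n\<in>UNIV. x n)"
    have "0 < Z"
      unfolding Z_def x_def by (intro sum_pos) auto
    have "((- 1 / (k * T)) *\<^sub>R H) *v a n = complex_of_real (- 1 / (k * T) * E n) *s a n" for n
      unfolding scaleR_matrix_vec E
      by (simp add: vec_eq_iff scaleR_conv_of_real[where 'a = complex])
    from mat_exp_diagonal[OF a this]
    have G: "mat_exp ((- 1 / (k * T)) *\<^sub>R H) = (\<Sum>n\<in>UNIV. x n *\<^sub>R outer (a n) (a n))"
      by (simp add: x_def)
    have "thermal_state k T H = (\<Sum>n\<in>UNIV. (x n / Z) *\<^sub>R outer (a n) (a n))"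
      unfolding thermal_state_def Let_def G trace_diagonal[OF a] Z_def[symmetric] if_not_P[OF False]
      by (simp add: vec_eq_iff scaleR_conv_of_real[where 'a = complex] sum_divide_distrib)
    moreover have "(\<Sum>n\<in>UNIV. x n / Z) = 1"
      using \<open>0 < Z\<close> by (simp add: Z_def flip: sum_divide_distrib)
    ultimately show thesis
      by (rule that)
  qed
qed

lemma eta_diagonal:
  fixes a :: "'n::finite \<Rightarrow> complex ^ 'n"
  assumes "orthonormal_basis a"
  shows "eta \<epsilon> (\<Sum>n\<in>UNIV. p n *\<^sub>R outer (a n) (a n)) *v a n
    = complex_of_real (p n + \<epsilon> / (1 - \<epsilon>) * (p n - 1 / real CARD('n))) *s a n"
  unfolding eta_def matrix_vector_mult_add_rdistrib scaleR_matrix_vec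
    matrix_vector_mult_diff_rdistrib diagonal_vec[OF assms]
  by (simp add: vec_eq_iff scaleR_conv_of_real[where 'a = complex] algebra_simps)

text \<open>Over a common denominator the eigenvalue is
  \<open>(d * p - \<epsilon>) / (d * (1 - \<epsilon>))\<close>, so the bound on \<epsilon> is
  exactly what keeps it nonnegative.\<close>

lemma eta_eigenvalue_nonneg:
  fixes p \<epsilon> d :: real
  assumes "\<epsilon> < 1" and "\<epsilon> \<le> d * p" and "0 < d"
  shows "0 \<le> p + \<epsilon> / (1 - \<epsilon>) * (p - 1 / d)"
proof -
  have "p + \<epsilon> / (1 - \<epsilon>) * (p - 1 / d) = (d * p - \<epsilon>) / (d * (1 - \<epsilon>))"
    using assms by (simp add: field_simps)
  then show ?thesis
    using assms by simp
qed

subsection \<open>Maximally entangled vectors\<close>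

text \<open>Each \<open>tensor_vec (a n) (b n)\<close> is a joint eigenvector with eigenvalue
  \<open>x n * y n\<close>. Orthogonality kills the cross terms, and the two normalization factors
  multiply to one over the dimension.\<close>

lemma expval_tensor_max_entangled:
  fixes a b :: "'n::finite \<Rightarrow> complex ^ 'n"
  assumes a: "orthonormal_basis a" and b: "orthonormal_basis b"
    and M: "\<And>n. M *v a n = complex_of_real (x n) *s a n"
    and N: "\<And>n. N *v b n = complex_of_real (y n) *s b n"
  shows "expval (tensor_mat M N) (max_entangled_vec a b)
    = complex_of_real ((\<Sum>n\<in>UNIV. x n * y n) / real CARD('n))"
proof -
  define s where "s = 1 / sqrt (real CARD('n))"
  have s: "s * s = 1 / real CARD('n)"
    by (simp add: s_def)
  have "tensor_mat M N *v max_entangled_vec a b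
      = s *\<^sub>R (\<Sum>n\<in>UNIV. (complex_of_real (x n * y n)) *s tensor_vec (a n) (b n))"
    unfolding max_entangled_vec_def s_def[symmetric]
    by (simp add: vec.sum tensor_mat_vec M N tensor_vec_scale matrix_vec_scaleR)
  then have expval: "expval (tensor_mat M N) (max_entangled_vec a b)
      = s *\<^sub>R s *\<^sub>R (\<Sum>n\<in>UNIV. complex_of_real (x n * y n))"
    unfolding expval_def
    by (simp add: max_entangled_vec_def s_def[symmetric] cinner_scaleR_left cinner_scaleR_right
        cinner_sum_left cinner_sum_right cinner_scale_right cinner_tensor_vec
        orthonormal_basis_cinner[OF a] orthonormal_basis_cinner[OF b] if_distrib scaleR_sum_right cong: if_cong)
  show ?thesis
    unfolding expval scaleR_scaleR s
    by (simp add: scaleR_conv_of_real[where 'a = complex])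
qed

lemma norm_max_entangled_le:
  fixes \<Phi> :: "complex ^ ('n::finite \<times> 'n)"
  assumes "maximally_entangled \<Phi>"
  shows "norm (\<Phi> $ p) \<le> real CARD('n)"
proof -
  obtain e f where e: "orthonormal_basis e" and f: "orthonormal_basis f"
    and \<Phi>: "\<Phi> = max_entangled_vec e f"
    using assms by (auto simp: maximally_entangled_def)
  have "1 \<le> sqrt (real CARD('n))"
    by (simp add: Suc_le_eq)
  then have s: "1 / sqrt (real CARD('n)) \<le> 1"
    by (simp add: divide_simps)
  have "norm (\<Sum>n\<in>UNIV. e n $ fst p * f n $ snd p) \<le> (\<Sum>n\<in>(UNIV::'n set). 1)"
    by (intro sum_norm_le)
      (simp add: norm_mult mult_le_one norm_orthonormal_basis_le_1[OF e]
        norm_orthonormal_basis_le_1[OF f])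
  then have "(1 / sqrt (real CARD('n))) * norm (\<Sum>n\<in>UNIV. e n $ fst p * f n $ snd p)
      \<le> 1 * real CARD('n)"
    using s by (intro mult_mono) auto
  then show ?thesis
    by (simp add: \<Phi> max_entangled_vec_def tensor_vec_def)
qed

lemma expval_le_fully_entangled_fraction:
  assumes "maximally_entangled \<Phi>"
  shows "Re (expval \<sigma> \<Phi>) \<le> fully_entangled_fraction \<sigma>"
  unfolding fully_entangled_fraction_def
proof (rule cSUP_upper)
  show "\<Phi> \<in> {\<Phi>. maximally_entangled \<Phi>}"
    using assms by simp
  let ?d = "real CARD('a)"
  \<comment> \<open>A real \<open>SUP\<close> dominates its members only if the set is bounded
    above; the bound below depends on \<sigma> and the dimension but not on \<Phi>.\<close>
  show "bdd_above ((\<lambda>\<Phi>. Re (expval \<sigma> \<Phi>)) ` {\<Phi>. maximally_entangled \<Phi>})"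
  proof (intro bdd_aboveI2)
    fix \<Phi> :: "complex ^ ('a \<times> 'a)" assume "\<Phi> \<in> {\<Phi>. maximally_entangled \<Phi>}"
    then have \<Phi>: "norm (\<Phi> $ p) \<le> ?d" for p
      by (simp add: norm_max_entangled_le)
    have "norm (expval \<sigma> \<Phi>) \<le> (\<Sum>i\<in>UNIV. ?d * (\<Sum>j\<in>UNIV. norm (\<sigma> $ i $ j) * ?d))"
      unfolding expval_def cinner_def matrix_vector_mult_def
      by (intro sum_norm_le)
        (auto simp: norm_mult intro!: mult_mono sum_norm_le \<Phi> sum_nonneg)
    then show "Re (expval \<sigma> \<Phi>) \<le> (\<Sum>i\<in>UNIV. ?d * (\<Sum>j\<in>UNIV. norm (\<sigma> $ i $ j) * ?d))"
      using complex_Re_le_cmod order_trans by blast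
  qed
qed

subsection \<open>Twirling\<close>

abbreviation local_conjugate_unitary ::
  "('n::finite \<Rightarrow> complex ^ 'n) \<Rightarrow> ('n \<Rightarrow> complex ^ 'n) \<Rightarrow> complex ^ 'n ^ 'n \<Rightarrow>
   complex ^ ('n \<times> 'n) ^ ('n \<times> 'n)" where
  "local_conjugate_unitary a b U \<equiv>
     tensor_mat (op_of_matrix a U) (op_of_matrix b (cnj_mat U))"

text \<open>The coefficient of \<open>tensor_vec (a m) (b l)\<close> in the image is, up to
  normalization, the \<open>(m, l)\<close> entry of \<open>dagger U ** U\<close>: the adjoint of
  \<open>cnj_mat U\<close> is the transpose of \<open>U\<close>, which supplies the unconjugated
  factor.\<close>

lemma max_entangled_invariant:
  fixes a b :: "'n::finite \<Rightarrow> complex ^ 'n"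
  assumes a: "orthonormal_basis a" and b: "orthonormal_basis b" and U: "U \<in> unitary_group"
  shows "dagger (local_conjugate_unitary a b U) *v max_entangled_vec a b = max_entangled_vec a b"
proof -
  let ?W = "dagger (local_conjugate_unitary a b U)"
  have UU: "(\<Sum>n\<in>UNIV. cnj (U $ n $ m) * U $ n $ l) = (if m = l then 1 else 0)" for m l
  proof -
    have "(dagger U ** U) $ m $ l = (if m = l then 1 else 0)"
      using U by (simp add: unitary_group_def mat_def)
    then show ?thesis
      by (simp add: matrix_matrix_mult_def dagger_def)
  qed
  have "(\<Sum>n\<in>UNIV. ?W *v tensor_vec (a n) (b n))
      = (\<Sum>n\<in>UNIV. \<Sum>m\<in>UNIV. \<Sum>l\<in>UNIV. (cnj (U $ n $ m) * U $ n $ l) *s tensor_vec (a m) (b l))"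
    by (simp add: dagger_tensor_mat dagger_op_of_matrix tensor_mat_vec op_of_matrix_basis[OF a]
        op_of_matrix_basis[OF b] tensor_vec_sum tensor_vec_scale)
      (simp add: dagger_def cnj_mat_def)
  \<comment> \<open>Two exchanges move the sum over \<open>n\<close> innermost, where
    \<open>UU\<close> evaluates it.\<close>
  also have "\<dots> = (\<Sum>m\<in>UNIV. \<Sum>n\<in>UNIV. \<Sum>l\<in>UNIV.
      (cnj (U $ n $ m) * U $ n $ l) *s tensor_vec (a m) (b l))"
    by (rule sum.swap)
  also have "\<dots> = (\<Sum>m\<in>UNIV. \<Sum>l\<in>UNIV. \<Sum>n\<in>UNIV.
      (cnj (U $ n $ m) * U $ n $ l) *s tensor_vec (a m) (b l))"
    by (intro sum.cong refl sum.swap)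
  also have "\<dots> = (\<Sum>m\<in>UNIV. tensor_vec (a m) (b m))"
    by (simp add: UU if_distrib[of "\<lambda>c. c *s _"] flip: vec.scale_sum_left cong: if_cong)
  finally show ?thesis
    by (simp add: max_entangled_vec_def matrix_vec_scaleR vec.sum)
qed

text \<open>The columns of a unitary matrix form an orthonormal basis, so all its entries have
  modulus at most 1.\<close>

lemma bounded_unitary_group: "bounded (unitary_group :: (complex ^ 'n ^ 'n) set)"
proof -
  have "norm U \<le> (\<Sum>i\<in>(UNIV :: 'n set). \<Sum>j\<in>(UNIV :: 'n set). 1)"
    if U: "U \<in> unitary_group" for U :: "complex ^ 'n ^ 'n"
  proof -
    have "orthonormal_basis (\<lambda>n. \<chi> i. U $ i $ n)"
      unfolding orthonormal_basis_def
    proof (intro allI)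
      fix m n
      have "(dagger U ** U) $ m $ n = (if m = n then 1 else 0)"
        using U by (simp add: unitary_group_def mat_def)
      then show "cinner (\<chi> i. U $ i $ m) (\<chi> i. U $ i $ n) = (if m = n then 1 else 0)"
        by (simp add: matrix_matrix_mult_def dagger_def cinner_def)
    qed
    then have "norm (U $ i $ j) \<le> 1" for i j
      using norm_orthonormal_basis_le_1 by fastforce
    then have "norm (U $ i) \<le> (\<Sum>j\<in>(UNIV :: 'n set). 1)" for i
      unfolding norm_vec_def[of "U $ i"] by (intro order_trans[OF L2_set_le_sum] sum_mono) auto
    then show ?thesis
      unfolding norm_vec_def[of U] by (intro order_trans[OF L2_set_le_sum] sum_mono) auto
  qed
  then show ?thesis
    by (auto simp: bounded_iff)
qed

text \<open>Every entry is a polynomial in the entries of \<open>U\<close> and their conjugates.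
  Continuity yields both measurability and boundedness of the twirl integrand.\<close>

lemma continuous_on_local_conjugation:
  "continuous_on S (\<lambda>U. local_conjugate_unitary a b U ** \<rho> ** dagger (local_conjugate_unitary a b U))"
  unfolding tensor_mat_def op_of_matrix_def cnj_mat_def dagger_def matrix_matrix_mult_def
  by (simp, intro continuous_intros)

text \<open>Once the expectation is taken inside the integral, the integrand is constant on the
  unitary group, and the measure has total mass 1.\<close>

lemma expval_twirl_max_entangled:
  fixes a b :: "'n::finite \<Rightarrow> complex ^ 'n"
  assumes a: "orthonormal_basis a" and b: "orthonormal_basis b"
    and \<mu>: "normalized_haar_measure \<mu>"
  shows "expval (twirl \<mu> a b \<rho>) (max_entangled_vec a b) = expval \<rho> (max_entangled_vec a b)"
proof -
  let ?f = "\<lambda>U. local_conjugate_unitary a b U ** \<rho> ** dagger (local_conjugate_unitary a b U)"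
  let ?\<Psi> = "max_entangled_vec a b"
  interpret prob_space \<mu>
    using \<mu> by (simp add: normalized_haar_measure_def)
  have sets: "sets \<mu> = sets (restrict_space borel unitary_group)"
    using \<mu> by (simp add: normalized_haar_measure_def)
  then have space: "space \<mu> = unitary_group"
    by (simp add: sets_eq_imp_space_eq space_restrict_space)
  \<comment> \<open>A closed ball around the group is compact, so the continuous integrand is
    bounded on it.\<close>
  obtain R where R: "unitary_group \<subseteq> cball (0 :: complex ^ 'n ^ 'n) R"
    using bounded_subset_ballD[OF bounded_unitary_group, of 0] ball_subset_cball
    by (meson order_trans)
  have "bounded (?f ` cball 0 R)"
    by (intro compact_imp_bounded compact_continuous_image continuous_on_local_conjugation
        compact_cball)
  then obtain B where B: "\<And>U. U \<in> cball 0 R \<Longrightarrow> norm (?f U) \<le> B"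
    unfolding bounded_iff by blast
  have "?f \<in> borel_measurable \<mu>"
    unfolding measurable_cong_sets[OF sets refl]
    by (intro measurable_restrict_space1 borel_measurable_continuous_onI
        continuous_on_local_conjugation)
  \<comment> \<open>Integrability has to be secured first: the Bochner integral of a non-integrable
    function is 0 by convention.\<close>
  then have int: "integrable \<mu> ?f"
    using B R space by (intro integrable_const_bound[where B = B] AE_I2) blast+
  have "bounded_linear (\<lambda>M. expval M ?\<Psi>)"
    using linear_expval linear_conv_bounded_linear by blast
  from integral_bounded_linear[OF this int]
  have "expval (twirl \<mu> a b \<rho>) ?\<Psi> = (\<integral>U. expval (?f U) ?\<Psi> \<partial>\<mu>)"
    by (simp add: twirl_def Let_def)
  also have "\<dots> = (\<integral>U. expval \<rho> ?\<Psi> \<partial>\<mu>)"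
    by (intro Bochner_Integration.integral_cong refl)
      (simp add: expval_conjugate max_entangled_invariant[OF a b] space)
  also have "\<dots> = expval \<rho> ?\<Psi>"
    by (simp add: prob_space)
  finally show ?thesis .
qed

section \<open>Lower bound on the fully entangled fraction\<close>

theorem proposition5:
  fixes H\<^sub>A H\<^sub>B \<gamma>\<^sub>A \<gamma>\<^sub>B :: "complex ^ 'n::{finite,linorder} ^ 'n::{finite,linorder}"
    and a b :: "'n \<Rightarrow> complex ^ 'n::{finite,linorder}"
    and k T\<^sub>A T\<^sub>B \<epsilon> :: real
    and \<mu> :: "(complex ^ 'n::{finite,linorder} ^ 'n::{finite,linorder}) measure"
  assumes "CARD('n) \<ge> 2"
    and "hermitian H\<^sub>A" and "nondegenerate H\<^sub>A" and "energy_eigenbasis H\<^sub>A a"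
    and "hermitian H\<^sub>B" and "nondegenerate H\<^sub>B" and "energy_eigenbasis H\<^sub>B b"
    and "k > 0" and "T\<^sub>A \<ge> 0" and "T\<^sub>B \<ge> 0"
    and "\<gamma>\<^sub>A = thermal_state k T\<^sub>A H\<^sub>A" and "\<gamma>\<^sub>B = thermal_state k T\<^sub>B H\<^sub>B"
    and "0 \<le> \<epsilon>" and "\<epsilon> \<le> real CARD('n) * min_eigenvalue \<gamma>\<^sub>A \<gamma>\<^sub>B"
    and "normalized_haar_measure \<mu>"
  shows "\<forall>\<rho>. density_operator \<rho> \<longrightarrow>
           fully_entangled_fraction (thermal_channel \<mu> a b \<gamma>\<^sub>A \<gamma>\<^sub>B \<epsilon> \<rho>)
             \<ge> \<epsilon> * Re (expval \<rho> (max_entangled_vec a b))"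
proof (intro allI impI)
  fix \<rho> :: "complex ^ ('n \<times> 'n) ^ ('n \<times> 'n)"
  let ?\<Psi> = "max_entangled_vec a b" and ?d = "real CARD('n)"
  have a: "orthonormal_basis a" and b: "orthonormal_basis b"
    using \<open>energy_eigenbasis H\<^sub>A a\<close> \<open>energy_eigenbasis H\<^sub>B b\<close> by (auto simp: energy_eigenbasis_def)
  obtain p where p: "\<gamma>\<^sub>A = (\<Sum>n\<in>UNIV. p n *\<^sub>R outer (a n) (a n))" and p1: "(\<Sum>n\<in>UNIV. p n) = 1"
    using thermal_state_diagonal[OF \<open>nondegenerate H\<^sub>A\<close> \<open>energy_eigenbasis H\<^sub>A a\<close>]
      \<open>\<gamma>\<^sub>A = thermal_state k T\<^sub>A H\<^sub>A\<close> by metis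
  obtain q where q: "\<gamma>\<^sub>B = (\<Sum>n\<in>UNIV. q n *\<^sub>R outer (b n) (b n))"
    using thermal_state_diagonal[OF \<open>nondegenerate H\<^sub>B\<close> \<open>energy_eigenbasis H\<^sub>B b\<close>]
      \<open>\<gamma>\<^sub>B = thermal_state k T\<^sub>B H\<^sub>B\<close> by metis
  define P where "P = min_eigenvalue \<gamma>\<^sub>A \<gamma>\<^sub>B"
  have "real_eigenvalues \<gamma>\<^sub>A = range p" "real_eigenvalues \<gamma>\<^sub>B = range q"
    using real_eigenvalues_diagonal[OF a] real_eigenvalues_diagonal[OF b]
      diagonal_vec[OF a] diagonal_vec[OF b] unfolding p q by blast+
  then have Pp: "P \<le> p n" and Pq: "P \<le> q n" for n
    by (simp_all add: P_def min_eigenvalue_def)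
  have \<epsilon>: "\<epsilon> \<le> ?d * P"
    using \<open>\<epsilon> \<le> ?d * min_eigenvalue \<gamma>\<^sub>A \<gamma>\<^sub>B\<close> by (simp add: P_def)
  \<comment> \<open>The smallest eigenvalue is at most the average of the \<open>p n\<close>, which
    is one over the dimension. Hence \<epsilon> is at most 1.\<close>
  have "?d * P \<le> 1"
    using sum_mono[of UNIV "\<lambda>_. P" p] Pp p1 by simp
  \<comment> \<open>The product term of the channel contributes nonnegatively, so only the twirled
    term remains in the lower bound.\<close>
  have "0 \<le> (1 - \<epsilon>) * Re (expval (tensor_mat (eta \<epsilon> \<gamma>\<^sub>A) (eta \<epsilon> \<gamma>\<^sub>B)) ?\<Psi>)"
  proof (cases "\<epsilon> < 1")
    case True
    have "\<epsilon> \<le> ?d * p n" "\<epsilon> \<le> ?d * q n" for n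
      using \<epsilon> Pp[of n] Pq[of n] by (meson mult_left_mono of_nat_0_le_iff order_trans)+
    then have "0 \<le> p n + \<epsilon> / (1 - \<epsilon>) * (p n - 1 / ?d)" "0 \<le> q n + \<epsilon> / (1 - \<epsilon>) * (q n - 1 / ?d)"
      for n
      using True by (intro eta_eigenvalue_nonneg; simp)+
    then show ?thesis
      using True
      unfolding p q Re_complex_of_real
        expval_tensor_max_entangled[OF a b eta_diagonal[OF a] eta_diagonal[OF b]]
      by (intro mult_nonneg_nonneg divide_nonneg_nonneg sum_nonneg) simp_all
  next
    \<comment> \<open>At \<epsilon> = 1 the quotient in \<open>eta\<close> is a division by zero,
      with value 0; the prefactor \<open>1 - \<epsilon>\<close> vanishes, so the value of
      \<open>eta\<close> there is immaterial.\<close>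
    case False
    then have "\<epsilon> = 1"
      using \<epsilon> \<open>?d * P \<le> 1\<close> by simp
    then show ?thesis
      by simp
  qed
  then have "\<epsilon> * Re (expval \<rho> ?\<Psi>) \<le> Re (expval (thermal_channel \<mu> a b \<gamma>\<^sub>A \<gamma>\<^sub>B \<epsilon> \<rho>) ?\<Psi>)"
    using expval_twirl_max_entangled[OF a b \<open>normalized_haar_measure \<mu>\<close>, of \<rho>]
    by (simp add: thermal_channel_def linear_add[OF linear_expval] linear_scale[OF linear_expval])
  also have "\<dots> \<le> fully_entangled_fraction (thermal_channel \<mu> a b \<gamma>\<^sub>A \<gamma>\<^sub>B \<epsilon> \<rho>)"
    using a b by (intro expval_le_fully_entangled_fraction) (auto simp: maximally_entangled_def)
  finally show "\<epsilon> * Re (expval \<rho> ?\<Psi>)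
      \<le> fully_entangled_fraction (thermal_channel \<mu> a b \<gamma>\<^sub>A \<gamma>\<^sub>B \<epsilon> \<rho>)" .
qed

end
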